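(* The mutation rule of the orbifold model coincides with the mutation rule of the mirror Markov tree up to powers of $q^{1/2}$. Precisely: start the orbifold model with loops $X,Y,Z$ in clockwise order and values $(x,y,z)=(1,1,1)$, mutate first at $Y$ and then at $X$ (this corresponds to the initial segment $(1,1,1)\to(1,1,1+q)\to(1,1+q,1+2q+2q^2)$ of the mirror Markov tree), and afterwards follow any descending path in the mirror Markov tree, mutating at each step the loop corresponding to the entry replaced along that edge of the tree. Then at each step the three values attached to the loops are equal to the three corresponding entries of the triple of the mirror Markov tree, each up to multiplication by an integer power of $q^{1/2}$.
   Context: Mirror Markov tree. For a polynomial $a(q)$ write $\tilde a(q)=q^{\deg a}a(q^{-1})$ and $A(q)=a(q)a(q^{-1})$ (corresponding capital letter). The mirror Markov tree is a tree of triples of polynomials with signed edges: the initial segment is $(1,1,1)\to(1,1,1+q)\to(1,1+q,1+2q+2q^2)$, both edges having sign $+$. From $(1,1+q,1+2q+2q^2)$ on, each triple $(a,b,c)$ has a left child $\left(a,c,q^{\deg c}\frac{q^{\eta}A+C}{\tilde b}\right)$ ($b$ is replaced) and a right child $\left(b,c,q^{\deg c}\frac{q^{\eta}B+C}{\tilde a}\right)$ ($a$ is replaced), where $\eta=\pm1$ is the sign of the edge. If the edge from the parent of $t$ to $t$ has sign $\epsilon$, then the left edge from $t$ has sign $\epsilon$ and the right edge from $t$ has sign $-\epsilon$. Orbifold model. Consider a sphere with one puncture and three orbifold points. A triangulation consists of three loops (pending arcs) based at the puncture, each around one orbifold point; the loops are cyclically ordered around the puncture. Mutating (flipping) a loop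 gives a triangulation of the same type which, up to homotopy, has the three loops in the opposite cyclic order. Each loop $W$ is replaced by a pair of tagged arcs $w,\tilde w$ that are always flipped simultaneously, carrying values (in $q^{1/2}$) with $W=w\tilde w$ and, in this model, $\tilde w(q)=w(q^{-1})$ (no power of $q$). Mutation rule: mutating at the loop $W$ replaces $w,\tilde w$ by $$w'=\frac{q^{1/2}N+q^{-1/2}P}{\tilde w},\qquad \tilde w'=\frac{q^{-1/2}N+q^{1/2}P}{w},$$ where $N$ is the loop following $W$ and $P$ the loop preceding $W$ in the clockwise order of the current triangulation (e.g. if $X,Y,Z$ are in clockwise order, then $x'=(q^{1/2}Y+q^{-1/2}Z)/\tilde x$); the other two loops keep their values, and the cyclic order of the three loops is reversed. *)

theory Defs
  imports "HOL-Computational_Algebra.Computational_Algebra"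
begin

section \<open>The field of rational functions in the square root of \<open>q\<close>\<close>

text \<open>All values live in the fraction field of \<open>\<int>[s]\<close>, with \<open>s = q\<^sup>1\<^sup>/\<^sup>2\<close>.\<close>

type_synonym qfield = "int poly fract"

definition qhalf :: qfield where
  "qhalf = to_fract [:0, 1:]"

definition qvar :: qfield where
  "qvar = qhalf ^ 2"

definition ev :: "int poly \<Rightarrow> qfield \<Rightarrow> qfield" where
  "ev a z = poly (map_poly of_int a) z"


section \<open>The mirror Markov tree\<close>

definition capital :: "int poly \<Rightarrow> qfield" where
  "capital a = ev a qvar * ev a (inverse qvar)"

text \<open>In \<open>new_entry \<eta> a c b\<close> the entry \<open>b\<close> is the one that is replaced, \<open>c\<close> is the last entry
  of the triple and \<open>\<eta>\<close>, one of \<open>1\<close> and \<open>-1\<close>, is the sign of the edge. The polynomial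
  \<open>q\<^bsup>deg b\<^esup> b(q\<^sup>-\<^sup>1)\<close> is \<open>reflect_poly b\<close>. The division takes place in the field; that its result
  is a polynomial is not part of the definition, and a value of \<open>new_entry\<close> is only known once
  this has been proved.\<close>

definition new_entry :: "int \<Rightarrow> int poly \<Rightarrow> int poly \<Rightarrow> int poly \<Rightarrow> int poly" where
  "new_entry \<eta> a c b = (THE p. ev p qvar =
     qvar ^ degree c * (qvar powi \<eta> * capital a + capital c) / ev (reflect_poly b) qvar)"

datatype direction = Go_Left | Go_Right

type_synonym 'a triple = "'a \<times> 'a \<times> 'a"

text \<open>A vertex is stored together with the sign of the edge from its parent.\<close>

fun child :: "direction \<Rightarrow> int poly triple \<times> int \<Rightarrow> int poly triple \<times> int" where
  "child Go_Left ((a, b, c), \<epsilon>) = ((a, c, new_entry \<epsilon> a c b), \<epsilon>)"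
| "child Go_Right ((a, b, c), \<epsilon>) = ((b, c, new_entry (- \<epsilon>) b c a), - \<epsilon>)"

text \<open>The vertex reached from \<open>(1, 1 + q, 1 + 2q + 2q\<^sup>2)\<close> by the given descending path.\<close>

definition mirror_vertex :: "direction list \<Rightarrow> int poly triple \<times> int" where
  "mirror_vertex ds = foldl (\<lambda>t d. child d t) ((1, [:1, 1:], [:1, 2, 2:]), 1) ds"

definition mirror_triple :: "direction list \<Rightarrow> int poly triple" where
  "mirror_triple ds = fst (mirror_vertex ds)"


section \<open>The orbifold model\<close>

datatype loop = LX | LY | LZ

text \<open>\<open>arc\<close> and \<open>tarc\<close> are the values of the two tagged arcs \<open>w\<close> and \<open>\<tilde>w\<close> replacing a loop,
  and \<open>cw\<close> sends a loop to the one that follows it in clockwise order.\<close>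

record orbifold_state =
  arc :: "loop \<Rightarrow> qfield"
  tarc :: "loop \<Rightarrow> qfield"
  cw :: "loop \<Rightarrow> loop"

definition loop_value :: "orbifold_state \<Rightarrow> loop \<Rightarrow> qfield" where
  "loop_value \<sigma> W = arc \<sigma> W * tarc \<sigma> W"

definition mutate :: "loop \<Rightarrow> orbifold_state \<Rightarrow> orbifold_state" where
  "mutate W \<sigma> =
    (let N = loop_value \<sigma> (cw \<sigma> W);
         P = loop_value \<sigma> (inv (cw \<sigma>) W)
     in \<lparr> arc = (arc \<sigma>)(W := (qhalf * N + inverse qhalf * P) / tarc \<sigma> W),
          tarc = (tarc \<sigma>)(W := (inverse qhalf * N + qhalf * P) / arc \<sigma> W),
          cw = inv (cw \<sigma>) \<rparr>)"

fun cw_XYZ :: "loop \<Rightarrow> loop" where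
  "cw_XYZ LX = LY"
| "cw_XYZ LY = LZ"
| "cw_XYZ LZ = LX"

definition initial_state :: orbifold_state where
  "initial_state = \<lparr> arc = (\<lambda>_. 1), tarc = (\<lambda>_. 1), cw = cw_XYZ \<rparr>"


subsection \<open>Compatibility with the symmetry exchanging \<open>q\<close> and its inverse\<close>

text \<open>\<open>q_inv f\<close> is \<open>f(q\<^sup>-\<^sup>1)\<close>. The relation \<open>\<tilde>w(q) = w(q\<^sup>-\<^sup>1)\<close> is not imposed on states:
  it holds initially and is preserved by mutation.\<close>

definition q_inv :: "qfield \<Rightarrow> qfield" where
  "q_inv f = ev (fst (quot_of_fract f)) (inverse qhalf) / ev (snd (quot_of_fract f)) (inverse qhalf)"

lemma ev_pCons: "ev (pCons c p) z = of_int c + z * ev p z"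
  by (simp add: ev_def map_poly_pCons)

lemma ev_0 [simp]: "ev 0 z = 0" and ev_1 [simp]: "ev 1 z = 1"
  by (simp_all add: ev_def)

lemma ev_add: "ev (p + r) z = ev p z + ev r z"
  by (induction p r rule: poly_induct2) (simp_all add: ev_pCons algebra_simps)

lemma ev_smult: "ev (smult c p) z = of_int c * ev p z"
  by (induction p) (simp_all add: ev_pCons algebra_simps)

lemma ev_mult: "ev (p * r) z = ev p z * ev r z"
  by (induction p) (simp_all add: ev_pCons ev_add ev_smult algebra_simps)

lemma qhalf_nonzero [simp]: "qhalf \<noteq> 0"
  by (simp add: qhalf_def)

lemma to_fract_of_int: "to_fract (of_int c :: int poly) = (of_int c :: qfield)"
proof -
  have n: "to_fract (of_nat n :: int poly) = (of_nat n :: qfield)" for n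
    by (induction n) simp_all
  show ?thesis
    by (cases c rule: int_cases2) (simp_all add: n)
qed

lemma ev_qhalf: "ev p qhalf = to_fract p"
proof (induction p)
  case 0
  then show ?case by simp
next
  case (pCons c p)
  have "to_fract (pCons c p) = to_fract (of_int c + [:0, 1:] * p)"
    by (simp add: of_int_poly)
  also have "\<dots> = of_int c + qhalf * to_fract p"
    by (simp only: to_fract_add to_fract_mult to_fract_of_int qhalf_def)
  finally show ?case
    by (simp add: ev_pCons pCons.IH)
qed

lemma ev_inverse_qhalf_nonzero: "ev p (inverse qhalf) \<noteq> 0" if "p \<noteq> 0"
proof -
  have "map_poly of_int (reflect_poly p) = reflect_poly (map_poly of_int p :: qfield poly)"
    by (simp add: poly_eq_iff coeff_map_poly coeff_reflect_poly degree_map_poly)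
  then have "ev (reflect_poly p) qhalf = qhalf ^ degree p * ev p (inverse qhalf)"
    by (simp add: ev_def poly_reflect_poly_nz degree_map_poly)
  moreover have "ev (reflect_poly p) qhalf \<noteq> 0"
    using that by (simp add: ev_qhalf)
  ultimately show ?thesis by auto
qed

lemma q_inv_Fract:
  assumes "b \<noteq> 0"
  shows "q_inv (to_fract a / to_fract b) = ev a (inverse qhalf) / ev b (inverse qhalf)"
proof -
  define f where "f = to_fract a / to_fract b"
  obtain u v where uv: "quot_of_fract f = (u, v)" by fastforce
  have v: "v \<noteq> 0" using uv by (metis snd_conv snd_quot_of_fract_nonzero)
  have "f = to_fract u / to_fract v"
    using uv  by (metis Fract_conv_to_fract fst_conv snd_conv Fract_quot_of_fract)
  hence "to_fract (u * b) = to_fract (a * v)"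
    using assms v by (simp add: f_def field_simps)
  hence "u * b = a * v" by (simp only: to_fract_eq_iff)
  hence "ev u (inverse qhalf) * ev b (inverse qhalf) = ev a (inverse qhalf) * ev v (inverse qhalf)"
    by (metis ev_mult)
  thus ?thesis
    using ev_inverse_qhalf_nonzero[OF assms] ev_inverse_qhalf_nonzero[OF v]
    by (simp add: q_inv_def uv flip: f_def) (simp add: field_simps)
qed

lemma qfield_cases:
  obtains a b where "b \<noteq> 0" "(f :: qfield) = to_fract a / to_fract b"
  by (metis Fract_conv_to_fract Fract_quot_of_fract snd_quot_of_fract_nonzero)

lemma q_inv_add: "q_inv (f + g) = q_inv f + q_inv g"
proof -
  obtain a b where f: "b \<noteq> 0" "f = to_fract a / to_fract b" by (rule qfield_cases)
  obtain c d where g: "d \<noteq> 0" "g = to_fract c / to_fract d" by (rule qfield_cases)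
  have "f + g = to_fract (a * d + c * b) / to_fract (b * d)"
    using f g by (simp add: field_simps)
  thus ?thesis
    using f g ev_inverse_qhalf_nonzero[OF f(1)] ev_inverse_qhalf_nonzero[OF g(1)]
    by (simp add: q_inv_Fract ev_add ev_mult del: to_fract_add to_fract_mult)
       (simp add: field_simps)
qed

lemma q_inv_mult: "q_inv (f * g) = q_inv f * q_inv g"
proof -
  obtain a b where f: "b \<noteq> 0" "f = to_fract a / to_fract b" by (rule qfield_cases)
  obtain c d where g: "d \<noteq> 0" "g = to_fract c / to_fract d" by (rule qfield_cases)
  have "f * g = to_fract (a * c) / to_fract (b * d)"
    using f g by (simp add: field_simps)
  thus ?thesis
    using f g by (simp add: q_inv_Fract ev_mult del: to_fract_mult)
qed

lemma q_inv_inverse: "q_inv (inverse f) = inverse (q_inv f)"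
proof -
  obtain a b where f: "b \<noteq> 0" "f = to_fract a / to_fract b" by (rule qfield_cases)
  show ?thesis
  proof (cases "a = 0")
    case True
    then have "f = 0" using f by simp
    moreover have "q_inv 0 = 0" by (simp add: q_inv_def)
    ultimately show ?thesis by simp
  next
    case False
    have "inverse f = to_fract b / to_fract a" using f by simp
    then show ?thesis
      using q_inv_Fract[OF False, of b] q_inv_Fract[OF f(1), of a] f(2) by simp
  qed
qed

lemma q_inv_qhalf: "q_inv qhalf = inverse qhalf"
  using q_inv_Fract[of 1 "[:0, 1:]"] by (simp add: qhalf_def ev_pCons)

lemma q_inv_to_fract: "q_inv (to_fract a) = ev a (inverse qhalf)"
  using q_inv_Fract[of 1 a] by simp

lemma q_inv_ev: "q_inv (ev p z) = ev p (q_inv z)"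
proof (induction p)
  case 0
  then show ?case by (simp add: q_inv_def)
next
  case (pCons c p)
  have "q_inv (of_int c) = of_int c"
    using q_inv_to_fract[of "[:c:]"] to_fract_of_int[of c]
    by (simp add: ev_pCons of_int_poly)
  then show ?case
    by (simp add: ev_pCons q_inv_add q_inv_mult pCons.IH)
qed

lemma q_inv_involution: "q_inv (q_inv f) = f"
proof -
  obtain a b where f: "b \<noteq> 0" "f = to_fract a / to_fract b" by (rule qfield_cases)
  have "q_inv (q_inv (to_fract p)) = to_fract p" for p
    by (simp add: q_inv_to_fract q_inv_ev q_inv_inverse q_inv_qhalf ev_qhalf)
  then show ?thesis
    by (simp add: f(2) divide_inverse q_inv_mult q_inv_inverse)
qed

lemma tarc_initial_state: "tarc initial_state W = q_inv (arc initial_state W)"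
  using q_inv_Fract[of 1 1] by (simp add: initial_state_def)

lemma tarc_mutate:
  assumes "\<And>V. tarc \<sigma> V = q_inv (arc \<sigma> V)"
  shows "tarc (mutate W \<sigma>) V = q_inv (arc (mutate W \<sigma>) V)"
  using assms
  by (simp add: mutate_def Let_def loop_value_def divide_inverse q_inv_add q_inv_mult
      q_inv_inverse q_inv_qhalf q_inv_involution mult_ac)


section \<open>Following a path of the tree in the orbifold model\<close>

text \<open>\<open>(i, j, k)\<close> are the loops corresponding to the entries \<open>(a, b, c)\<close> of a triple. The
  mutated loop keeps its name and corresponds to the new last entry.\<close>

fun follow_step :: "direction \<Rightarrow> loop triple \<times> orbifold_state \<Rightarrow> loop triple \<times> orbifold_state" where
  "follow_step Go_Left ((i, j, k), \<sigma>) = ((i, k, j), mutate j \<sigma>)"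
| "follow_step Go_Right ((i, j, k), \<sigma>) = ((j, k, i), mutate i \<sigma>)"

definition follow :: "direction list \<Rightarrow> loop triple \<times> orbifold_state" where
  "follow ds = foldl (\<lambda>t d. follow_step d t)
     ((LZ, LY, LX), mutate LX (mutate LY initial_state)) ds"

definition eq_upto_qhalf :: "qfield \<Rightarrow> int poly \<Rightarrow> bool" where
  "eq_upto_qhalf w a \<longleftrightarrow> (\<exists>m :: int. w = qhalf powi m * ev a qvar)"

fun matches :: "loop triple \<times> orbifold_state \<Rightarrow> int poly triple \<Rightarrow> bool" where
  "matches ((i, j, k), \<sigma>) (a, b, c) \<longleftrightarrow>
     eq_upto_qhalf (arc \<sigma> i) a \<and> eq_upto_qhalf (arc \<sigma> j) b \<and> eq_upto_qhalf (arc \<sigma> k) c"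

end

theory Submission imports Defs begin

text \<open>
  Write \<open>X = x(q) x(1/q)\<close> for the norm of a value \<open>x\<close>. Norms ignore powers of \<open>q\<^sup>1\<^sup>/\<^sup>2\<close>, so both
  mutation rules send \<open>y\<close> to a power of \<open>q\<^sup>1\<^sup>/\<^sup>2\<close> times \<open>(t X + Z) / y(1/q)\<close>, where \<open>t\<close> is \<open>q\<close> or \<open>1/q\<close>:
  in the tree \<open>t = q\<^bsup>\<epsilon>\<^esup>\<close> for the sign \<open>\<epsilon>\<close> of the edge, and in the orbifold model \<open>t = q\<close> exactly if
  the loop of \<open>X\<close> follows that of \<open>Y\<close>. So the cyclic order of the loops of a triple
  \<open>(a, b, c)\<close> encodes the sign of its edge. A left step replaces the middle entry and
  reverses both the cyclic order and the positions of the last two loops, which cancel; a right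
  step is a left step after exchanging the first two entries and negating the sign. This is
  the content of \<open>models_mutate\<close> and \<open>models_swap\<close>.

  The comparison makes sense only if the quotients defining the tree are polynomials, and
  this is where the work lies. Two facts give it.

  The first is a Laurent property. With \<open>\<lambda> = q + 1/q\<close>, the norms of every triple satisfy
  the Markov equation \<open>X\<^sup>2 + Y\<^sup>2 + Z\<^sup>2 + \<lambda> (XY + YZ + ZX) = 3 (1 + \<lambda>) XYZ\<close>: as a quadratic equation
  in \<open>X\<close> its second root is \<open>X' = (Y\<^sup>2 + \<lambda> YZ + Z\<^sup>2) / X\<close>, the norm of the mutated value.
  The sum of the two roots then expresses \<open>X'\<close> without division, and inserting this
  into the exchange relation at \<open>y\<close> after the mutation at \<open>x\<close> turns the new value there
  into a combination of \<open>y\<close> and of the value that a mutation at \<open>y\<close> would have given before,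
  with coefficients in \<open>\<int>[q, 1/q]\<close>. Hence if a triple and its three neighbours are
  integral Laurent polynomials, then so are the neighbours of its neighbours
  (\<open>markov_seed_mutate\<close>).

  The second is a degree argument (\<open>new_entry_props\<close>): the last entry of a triple has the largest
  degree, so the numerator that defines the next entry is a polynomial, and the denominator has
  non-zero constant coefficient, so a Laurent polynomial quotient is a polynomial. The extreme
  coefficients of all entries are positive, which prevents cancellation and fixes the degree of
  the new entry.
\<close>

section \<open>Evaluation at \<open>q\<close>\<close>

lemma qvar_nonzero [simp]: "qvar \<noteq> 0"
  by (simp add: qvar_def)

text \<open>The element \<open>q\<close> is transcendental, so a polynomial is determined by its value
  there.\<close>

lemma ev_qvar_inject: "ev p qvar = ev r qvar \<longleftrightarrow> p = r"
proof -
  have as_compose: "ev p qvar = to_fract (pcompose p [:0, 0, 1:])" for p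
  proof (induction p)
    case (pCons c p)
    have "pcompose (pCons c p) [:0, 0, 1:] = of_int c + [:0, 1:] ^ 2 * pcompose p [:0, 0, 1:]"
      by (simp add: pcompose_pCons power2_eq_square of_int_poly)
    hence "to_fract (pcompose (pCons c p) [:0, 0, 1:])
        = of_int c + qvar * to_fract (pcompose p [:0, 0, 1:])"
      by (simp only: to_fract_add to_fract_mult to_fract_of_int qvar_def qhalf_def power2_eq_square)
    thus ?case
      by (simp add: ev_pCons pCons.IH)
  qed simp
  have "pcompose (p - r) [:0, 0, 1:] = 0 \<longleftrightarrow> p - r = 0"
    by (rule pcompose_eq_0_iff) simp
  thus ?thesis
    by (simp add: as_compose pcompose_diff)
qed

lemma ev_qvar_eq_0_iff [simp]: "ev p qvar = 0 \<longleftrightarrow> p = 0"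
  using ev_qvar_inject[of p 0] by simp

lemma ev_monom: "ev (monom 1 n) z = z ^ n"
  by (induction n) (simp_all add: monom_Suc ev_pCons)

lemma ev_reflect_poly:
  assumes "z \<noteq> 0"
  shows "ev (reflect_poly p) z = z ^ degree p * ev p (inverse z)"
proof -
  have "map_poly of_int (reflect_poly p) = reflect_poly (map_poly of_int p :: qfield poly)"
    by (simp add: poly_eq_iff coeff_map_poly coeff_reflect_poly degree_map_poly)
  with assms show ?thesis
    by (simp add: ev_def poly_reflect_poly_nz degree_map_poly)
qed

lemma q_inv_0 [simp]: "q_inv 0 = 0"
  by (simp add: q_inv_def)

lemma q_inv_1 [simp]: "q_inv 1 = 1"
  using q_inv_to_fract[of 1] by simp

lemma q_inv_qvar: "q_inv qvar = inverse qvar"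
  by (simp add: qvar_def power2_eq_square q_inv_mult q_inv_qhalf)

lemma q_inv_eq_0_iff [simp]: "q_inv f = 0 \<longleftrightarrow> f = 0"
  by (metis q_inv_0 q_inv_involution)

lemma q_inv_divide: "q_inv (f / g) = q_inv f / q_inv g"
  by (simp add: divide_inverse q_inv_mult q_inv_inverse)

lemma q_inv_power: "q_inv (f ^ n) = q_inv f ^ n"
  by (induction n) (simp_all add: q_inv_mult)

lemma q_inv_powi: "q_inv (f powi m) = q_inv f powi m"
  by (simp add: power_int_def q_inv_power q_inv_inverse)

section \<open>Integral Laurent polynomials\<close>

definition laurent :: "qfield set" where
  "laurent = {f. \<exists>p n. f * qvar ^ n = ev p qvar}"

lemma laurent_ev [simp]: "ev p qvar \<in> laurent"
  unfolding laurent_def by (intro CollectI exI[of _ p] exI[of _ 0]) simp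

lemma laurent_add: "f \<in> laurent \<Longrightarrow> g \<in> laurent \<Longrightarrow> f + g \<in> laurent"
proof -
  assume "f \<in> laurent" "g \<in> laurent"
  then obtain p m r n where *: "ev p qvar = f * qvar ^ m" "ev r qvar = g * qvar ^ n"
    unfolding laurent_def by (smt (verit) mem_Collect_eq)
  hence "(f + g) * qvar ^ (m + n) = ev (p * monom 1 n + r * monom 1 m) qvar"
    by (simp add: ev_add ev_mult ev_monom power_add algebra_simps)
  thus ?thesis unfolding laurent_def by blast
qed

lemma laurent_mult: "f \<in> laurent \<Longrightarrow> g \<in> laurent \<Longrightarrow> f * g \<in> laurent"
proof -
  assume "f \<in> laurent" "g \<in> laurent"
  then obtain p m r n where *: "ev p qvar = f * qvar ^ m" "ev r qvar = g * qvar ^ n"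
    unfolding laurent_def by (smt (verit) mem_Collect_eq)
  hence "(f * g) * qvar ^ (m + n) = ev (p * r) qvar"
    by (simp add: ev_mult power_add mult_ac)
  thus ?thesis unfolding laurent_def by blast
qed

lemma laurent_1 [simp]: "1 \<in> laurent"
  using laurent_ev[of 1] by simp

lemma laurent_uminus: "f \<in> laurent \<Longrightarrow> - f \<in> laurent"
  using laurent_mult[OF laurent_ev[of "[:-1:]"]] by (simp add: ev_pCons)

lemma laurent_diff: "f \<in> laurent \<Longrightarrow> g \<in> laurent \<Longrightarrow> f - g \<in> laurent"
  using laurent_add[of f "- g"] by (simp add: laurent_uminus)

lemma laurent_numeral [simp]: "numeral n \<in> laurent"
  using laurent_ev[of "[:numeral n:]"] by (simp add: ev_pCons)

lemma laurent_power: "f \<in> laurent \<Longrightarrow> f ^ n \<in> laurent"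
  by (induction n) (auto intro: laurent_mult)

lemma laurent_qvar [simp]: "qvar \<in> laurent"
  using laurent_ev[of "[:0, 1:]"] by (simp add: ev_pCons)

lemma laurent_inverse_qvar [simp]: "inverse qvar \<in> laurent"
  unfolding laurent_def by (auto intro!: exI[of _ 1])

lemma laurent_qvar_powi [simp]: "qvar powi m \<in> laurent"
  by (simp add: power_int_def laurent_power)

lemma laurent_q_inv: "f \<in> laurent \<Longrightarrow> q_inv f \<in> laurent"
proof -
  assume "f \<in> laurent"
  then obtain p n where "f * qvar ^ n = ev p qvar"
    by (auto simp: laurent_def)
  hence "q_inv f * inverse qvar ^ n = ev p (inverse qvar)"
    by (metis q_inv_ev q_inv_mult q_inv_power q_inv_qvar)
  also have "\<dots> = inverse qvar ^ degree p * ev (reflect_poly p) qvar"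
    by (simp add: ev_reflect_poly power_inverse)
  finally have "q_inv f = qvar ^ n * (inverse qvar ^ degree p * ev (reflect_poly p) qvar)"
    by (simp add: field_simps)
  thus ?thesis
    by (simp add: laurent_mult laurent_power)
qed

lemmas laurent_closed = laurent_add laurent_mult laurent_uminus laurent_power laurent_q_inv

section \<open>Exchange relations and the Markov equation\<close>

text \<open>For an arc this is the value of its loop, and for a polynomial evaluated at \<open>q\<close> it is
  the capital letter.\<close>

definition nrm :: "qfield \<Rightarrow> qfield" where
  "nrm x = x * q_inv x"

text \<open>The value that replaces \<open>x\<close>, up to a power of \<open>q\<^sup>1\<^sup>/\<^sup>2\<close>, in both models. Replacing \<open>t\<close> by its
  inverse and exchanging \<open>y\<close> and \<open>z\<close> multiplies it by \<open>t\<^sup>-\<^sup>1\<close>.\<close>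

definition exchange :: "qfield \<Rightarrow> qfield \<Rightarrow> qfield \<Rightarrow> qfield \<Rightarrow> qfield" where
  "exchange t x y z = (t * nrm y + nrm z) / q_inv x"

definition lam :: qfield where
  "lam = qvar + inverse qvar"

text \<open>The constant \<open>3 (1 + \<lambda>)\<close> is fixed by the solution \<open>(1, 1, 1)\<close>.\<close>

definition markov_eq :: "qfield \<Rightarrow> qfield \<Rightarrow> qfield \<Rightarrow> bool" where
  "markov_eq X Y Z \<longleftrightarrow>
     X^2 + Y^2 + Z^2 + lam * (X * Y + Y * Z + Z * X) = 3 * (1 + lam) * X * Y * Z"

text \<open>The triple is cyclically ordered, and \<open>t\<close> records the orientation. Asking for integrality of
  the three neighbouring values, besides that of the triple itself, is what makes
  the property hereditary.\<close>

definition markov_seed :: "qfield \<Rightarrow> qfield \<Rightarrow> qfield \<Rightarrow> qfield \<Rightarrow> bool" where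
  "markov_seed t x y z \<longleftrightarrow>
     t \<in> {qvar, inverse qvar} \<and> 0 \<notin> {x, y, z} \<and> {x, y, z} \<subseteq> laurent \<and>
     markov_eq (nrm x) (nrm y) (nrm z) \<and>
     {exchange t x y z, exchange t y z x, exchange t z x y} \<subseteq> laurent"

lemma markov_eq_rotate: "markov_eq X Y Z \<Longrightarrow> markov_eq Y Z X"
  by (simp add: markov_eq_def algebra_simps)

lemma markov_seed_rotate: "markov_seed t x y z \<Longrightarrow> markov_seed t y z x"
  by (auto simp: markov_seed_def markov_eq_rotate)

lemma laurent_lam [simp]: "lam \<in> laurent"
  by (simp add: lam_def laurent_closed)

lemma laurent_nrm: "x \<in> laurent \<Longrightarrow> nrm x \<in> laurent"
  by (simp add: nrm_def laurent_closed)

lemma q_inv_nrm: "q_inv (nrm x) = nrm x"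
  by (simp add: nrm_def q_inv_mult q_inv_involution mult.commute)

lemma nrm_eq_0_iff [simp]: "nrm x = 0 \<longleftrightarrow> x = 0"
  by (simp add: nrm_def)

lemma nrm_1 [simp]: "nrm 1 = 1"
  by (simp add: nrm_def)

lemma nrm_mult: "nrm (x * y) = nrm x * nrm y"
  by (simp add: nrm_def q_inv_mult mult_ac)

lemma nrm_qhalf_powi [simp]: "nrm (qhalf powi m) = 1"
  by (simp add: nrm_def q_inv_powi q_inv_qhalf power_int_inverse)

lemma nrm_qvar_powi [simp]: "nrm (qvar powi m) = 1"
  by (simp add: nrm_def q_inv_powi q_inv_qvar power_int_inverse)

text \<open>Reading the triple in the opposite cyclic order inverts \<open>t\<close>.\<close>

lemma markov_seed_swap: "markov_seed t x y z \<Longrightarrow> markov_seed (inverse t) x z y"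
proof -
  assume s: "markov_seed t x y z"
  hence t: "t \<noteq> 0" "inverse t \<in> laurent"
    by (auto simp: markov_seed_def)
  have "exchange (inverse t) u w v = inverse t * exchange t u v w" for u v w
    using t by (simp add: exchange_def field_simps)
  with s t show ?thesis
    by (auto simp: markov_seed_def markov_eq_def laurent_mult algebra_simps)
qed

lemma markov_seed_scale: "markov_seed t x y z \<Longrightarrow> markov_seed t (qvar powi m * x) y z"
proof -
  assume s: "markov_seed t x y z"
  have "inverse (q_inv (qvar powi m)) = qvar powi m"
    by (simp add: q_inv_powi q_inv_qvar power_int_inverse)
  hence "exchange t (qvar powi m * x) y z = qvar powi m * exchange t x y z"
    by (simp add: exchange_def q_inv_mult divide_inverse)
  moreover have "exchange t y z (qvar powi m * x) = exchange t y z x"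
    "exchange t z (qvar powi m * x) y = exchange t z x y"
    by (simp_all add: exchange_def nrm_mult)
  ultimately show ?thesis
    using s by (simp add: markov_seed_def nrm_mult laurent_mult)
qed

lemma lam_eq: "t \<in> {qvar, inverse qvar} \<Longrightarrow> lam = t + inverse t"
  by (auto simp: lam_def)

text \<open>The product of the two roots of the Markov equation in \<open>nrm x\<close>: the factor
  \<open>t Y + Z\<close> and its image \<open>t\<^sup>-\<^sup>1 Y + Z\<close> under \<open>q \<mapsto> 1/q\<close> multiply to
  \<open>Y\<^sup>2 + (t + t\<^sup>-\<^sup>1) Y Z + Z\<^sup>2\<close>.\<close>

lemma nrm_exchange:
  assumes "t \<in> {qvar, inverse qvar}" "x \<noteq> 0"
  shows "nrm (exchange t x y z) * nrm x = nrm y ^ 2 + lam * nrm y * nrm z + nrm z ^ 2"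
proof -
  have t: "t \<noteq> 0" "q_inv t = inverse t"
    using assms by (auto simp: q_inv_qvar q_inv_inverse)
  have "nrm (exchange t x y z) * nrm x
      = (t * nrm y + nrm z) * (inverse t * nrm y + nrm z)"
    using assms t unfolding nrm_def[of "exchange t x y z"]
    by (simp add: exchange_def q_inv_divide q_inv_add q_inv_mult q_inv_nrm q_inv_involution)
       (simp add: nrm_def field_simps)
  also have "\<dots> = nrm y ^ 2 + (t + inverse t) * nrm y * nrm z + nrm z ^ 2"
    using t by (simp add: algebra_simps power2_eq_square)
  finally show ?thesis
    by (simp only: lam_eq[OF assms(1)])
qed

text \<open>The neighbours of the mutated triple are the old value \<open>t x\<close> and, at \<open>y\<close> and \<open>z\<close>, linear
  combinations of the old value and of the old neighbour there, because the Markov equation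
  makes the new norm a polynomial in the three old norms.\<close>

lemma markov_seed_mutate:
  assumes s: "markov_seed t x y z" and nz: "exchange t x y z \<noteq> 0"
  shows "markov_seed t (exchange t x y z) z y"
proof -
  define x' where "x' = exchange t x y z"
  define X where "X = nrm x"
  define Y where "Y = nrm y"
  define Z where "Z = nrm z"
  define X' where "X' = nrm x'"
  note defs = X_def Y_def Z_def X'_def
  have t: "t \<in> {qvar, inverse qvar}" "t \<noteq> 0" "q_inv t = inverse t" "t \<in> laurent" "inverse t \<in> laurent"
    using s by (auto simp: markov_seed_def q_inv_qvar q_inv_inverse)
  have nz': "x \<noteq> 0" "y \<noteq> 0" "z \<noteq> 0" "X \<noteq> 0"
    using s by (auto simp: markov_seed_def defs)
  have L: "x \<in> laurent" "y \<in> laurent" "z \<in> laurent" "x' \<in> laurent" "exchange t y z x \<in> laurent"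
    "exchange t z x y \<in> laurent" "Y \<in> laurent" "Z \<in> laurent"
    using s by (auto simp: markov_seed_def x'_def defs intro!: laurent_nrm)
  have eq: "X^2 + Y^2 + Z^2 + lam * (X * Y + Y * Z + Z * X) = 3 * (1 + lam) * X * Y * Z"
    using s by (simp add: markov_seed_def markov_eq_def defs)
  have prod: "X' * X = Y^2 + lam * Y * Z + Z^2"
    using nrm_exchange[OF t(1) nz'(1)] by (simp add: defs x'_def)
  \<comment> \<open>Replacing \<open>Y\<^sup>2 + \<lambda> YZ + Z\<^sup>2\<close> by \<open>X X'\<close> makes the Markov equation divisible by \<open>X\<close>, and
    multiplying the quotient by \<open>X'\<close> gives the equation for \<open>X'\<close>.\<close>
  have "X * (X + X' + lam * (Y + Z)) = X * (3 * (1 + lam) * Y * Z)"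
    using eq prod by (simp add: algebra_simps power2_eq_square)
  hence sum: "X + X' + lam * (Y + Z) = 3 * (1 + lam) * Y * Z"
    using nz' by simp
  have "X' * (X + X' + lam * (Y + Z)) = X' * (3 * (1 + lam) * Y * Z)"
    by (simp only: sum)
  hence markov: "markov_eq X' Z Y"
    unfolding markov_eq_def using prod by (simp add: algebra_simps power2_eq_square)
  have lam: "lam = t + inverse t"
    by (rule lam_eq[OF t(1)])
  have t_lam: "t * lam = t^2 + 1"
    using t(2) by (simp add: lam distrib_left power2_eq_square)
  have quotient: "Y / q_inv y = y" "Z / q_inv z = z"
    using nz' by (simp_all add: defs nrm_def)
  have split_quotient: "(u * v + w * r) / d = u * (v / d) + w / d * r" for u v w r d :: qfield
    by (simp add: add_divide_distrib)
  have X': "X' = 3 * (1 + lam) * Y * Z - lam * (Y + Z) - X"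
    using sum by (simp add: algebra_simps)
  have "exchange t x' z y = t * x"
  proof -
    have "q_inv x' = (inverse t * Y + Z) / x"
      by (simp add: x'_def exchange_def q_inv_divide q_inv_add q_inv_mult q_inv_nrm
          q_inv_involution t defs)
    moreover have "inverse t * Y + Z \<noteq> 0"
      using calculation nz x'_def nz' by (metis div_0 q_inv_eq_0_iff)
    moreover have "t * Z + Y = t * (inverse t * Y + Z)"
      using t by (simp add: algebra_simps)
    ultimately show ?thesis
      using nz' by (simp add: exchange_def flip: defs) 
  qed
  moreover have "exchange t y x' z = - t * exchange t y z x + y * (t * (3 * (1 + lam) * Z - lam))"
  proof -
    \<comment> \<open>Since \<open>t \<lambda> = t\<^sup>2 + 1\<close>, the terms free of \<open>Y\<close> are \<open>- t\<close> times the numerator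
      \<open>t Z + X\<close> of the exchange at \<open>y\<close> before the mutation; a multiple of \<open>Y\<close> remains.\<close>
    have "t * X' + Z = 3 * (1 + lam) * Y * Z * t - (t * lam) * Z - t * lam * Y - t * X + Z"
      by (simp add: X' algebra_simps)
    also have "\<dots> = - t * (t * Z + X) + Y * (t * (3 * (1 + lam) * Z - lam))"
      using t_lam by algebra
    finally have "(t * X' + Z) / q_inv y
        = - t * ((t * Z + X) / q_inv y) + Y / q_inv y * (t * (3 * (1 + lam) * Z - lam))"
      by (simp only: split_quotient)
    thus ?thesis
      unfolding quotient by (simp only: exchange_def flip: defs)
  qed
  moreover have "exchange t z y x' = - inverse t * exchange t z x y + z * (3 * (1 + lam) * Y - lam)"
  proof -
    have "t * Y + X' = t * Y + 3 * (1 + lam) * Y * Z - lam * Z - lam * Y - X"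
      by (simp add: X' algebra_simps)
    also have "\<dots> = - inverse t * (t * X + Y) + Z * (3 * (1 + lam) * Y - lam)"
    proof -
      have "lam * Y = t * Y + inverse t * Y"
        by (simp add: lam distrib_right)
      thus ?thesis using t(2) by (simp add: algebra_simps)
    qed
    finally have "(t * Y + X') / q_inv z
        = - inverse t * ((t * X + Y) / q_inv z) + Z / q_inv z * (3 * (1 + lam) * Y - lam)"
      by (simp only: split_quotient)
    thus ?thesis
      unfolding quotient by (simp only: exchange_def flip: defs)
  qed
  ultimately have "exchange t x' z y \<in> laurent" "exchange t y x' z \<in> laurent"
    "exchange t z y x' \<in> laurent"
    using L t by (simp_all add: laurent_closed laurent_diff)
  thus ?thesis
    using markov L nz' nz t(1)
    by (simp add: markov_seed_def flip: defs x'_def)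
qed

text \<open>A left step of the tree, for the cyclic order \<open>(b, a, c)\<close> of a triple \<open>(a, b, c)\<close>: it keeps
  \<open>t\<close>, because the new triple \<open>(a, c, p)\<close> is again read with its first two entries exchanged.\<close>

lemma markov_seed_child:
  assumes "markov_seed t y x z" and "p = qvar powi n * exchange t y x z" and "p \<noteq> 0"
  shows "markov_seed t z x p"
proof -
  have "markov_seed t (exchange t y x z) z x"
    using assms by (intro markov_seed_mutate) auto
  thus ?thesis
    unfolding assms(2) by (intro markov_seed_rotate[OF markov_seed_scale])
qed

lemma markov_seed_1: "markov_seed qvar 1 1 1"
  by (simp add: markov_seed_def markov_eq_def exchange_def nrm_def laurent_add)

section \<open>The entries of the mirror Markov tree\<close>

lemma nrm_ev: "nrm (ev a qvar) = capital a"
  by (simp add: nrm_def capital_def q_inv_ev q_inv_qvar)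

lemma qvar_power_dvd_cancel:
  fixes p d :: "int poly"
  assumes "monom 1 m dvd p * d" "coeff d 0 \<noteq> 0"
  shows "monom 1 m dvd p"
proof (cases "p = 0")
  case False
  have "d \<noteq> 0" "poly d 0 \<noteq> 0"
    using assms by (auto simp: poly_0_coeff_0)
  with False assms show ?thesis
    by (simp add: monom_1_dvd_iff order_mult order_0I)
qed simp

lemma new_entry_eqI:
  assumes "ev p qvar =
    qvar ^ degree c * (qvar powi \<eta> * capital a + capital c) / ev (reflect_poly b) qvar"
  shows "new_entry \<eta> a c b = p"
  unfolding new_entry_def assms[symmetric] by (simp add: ev_qvar_inject)

text \<open>A positive constant coefficient lets reflection preserve the degree, and positivity at both
  ends survives sums of polynomials, so that the extreme terms of \<open>q\<^bsup>\<eta>\<^esup> A + C\<close> cannot cancel.\<close>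

definition positive_ends :: "int poly \<Rightarrow> bool" where
  "positive_ends p \<longleftrightarrow> coeff p 0 > 0 \<and> lead_coeff p > 0"

lemma
  assumes "positive_ends p"
  shows degree_reflect_positive_ends: "degree (reflect_poly p) = degree p"
    and lead_coeff_reflect_positive_ends: "lead_coeff (reflect_poly p) = coeff p 0"
  using assms by (simp_all add: positive_ends_def coeff_reflect_poly)

text \<open>After multiplication by \<open>q\<^bsup>deg c\<^esup>\<close> the numerator becomes the polynomial
  \<open>q\<^bsup>k\<^esup> a a\<^sup>* + c c\<^sup>*\<close> with \<open>k = deg c + \<eta> - deg a\<close>, where \<open>k \<ge> 0\<close> since \<open>deg a < deg c\<close>.
  Here the star marks the reflected polynomial. The quotient by \<open>b\<^sup>*\<close> is a Laurent polynomial,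
  and no power of \<open>q\<close> is needed in the denominator because the constant coefficient of \<open>b\<^sup>*\<close>
  does not vanish.\<close>

lemma new_entry_props:
  assumes \<eta>: "\<eta> \<in> {1, -1 :: int}"
    and pos: "positive_ends a" "positive_ends b" "positive_ends c"
    and deg: "degree a < degree c"
    and L: "exchange (qvar powi \<eta>) (ev b qvar) (ev a qvar) (ev c qvar) \<in> laurent"
  defines "p \<equiv> new_entry \<eta> a c b"
  shows "ev p qvar = qvar powi (int (degree c) - int (degree b)) *
           exchange (qvar powi \<eta>) (ev b qvar) (ev a qvar) (ev c qvar)"
    and "positive_ends p"
    and "degree p + degree b = 2 * degree c"
proof -
  define E where "E = exchange (qvar powi \<eta>) (ev b qvar) (ev a qvar) (ev c qvar)"
  define k where "k = nat (int (degree c) + \<eta> - int (degree a))"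
  have k: "int k = int (degree c) + \<eta> - int (degree a)" "k + 2 * degree a \<le> 2 * degree c"
    using \<eta> deg by (auto simp: k_def)
  have nz: "a \<noteq> 0" "b \<noteq> 0" "c \<noteq> 0"
    using pos by (auto simp: positive_ends_def)
  define f where "f = monom 1 k * (a * reflect_poly a)"
  define g where "g = c * reflect_poly c"
  define V where "V = qvar ^ degree c * (qvar powi \<eta> * capital a + capital c)
    / ev (reflect_poly b) qvar"
  have V: "V = qvar powi (int (degree c) - int (degree b)) * E"
    by (simp add: V_def E_def exchange_def nrm_ev ev_reflect_poly q_inv_ev q_inv_qvar
        power_int_diff field_simps)
  have ev_g: "ev g qvar = qvar ^ degree c * capital c"
    by (simp add: g_def ev_mult ev_reflect_poly capital_def)
  have "qvar ^ k * qvar ^ degree a = qvar powi (int k + int (degree a))"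
    by (simp add: power_int_add)
  also have "\<dots> = qvar ^ degree c * qvar powi \<eta>"
    by (simp add: k(1) power_int_add)
  finally have ev_f: "ev f qvar = qvar ^ degree c * (qvar powi \<eta> * capital a)"
    by (simp add: f_def ev_mult ev_monom ev_reflect_poly capital_def)
  have V_mult: "V * ev (reflect_poly b) qvar = ev (f + g) qvar"
    using nz by (simp add: V_def ev_add ev_f ev_g distrib_left)
  have "V \<in> laurent"
    unfolding V using L by (simp add: E_def laurent_mult)
  then obtain r m where r: "V * qvar ^ m = ev r qvar"
    by (auto simp: laurent_def)
  have "ev (r * reflect_poly b) qvar = ev (monom 1 m * (f + g)) qvar"
    by (simp only: ev_mult ev_monom flip: r V_mult) (simp only: mult_ac)
  hence "r * reflect_poly b = monom 1 m * (f + g)"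
    by (simp only: ev_qvar_inject)
  hence "monom 1 m dvd r"
    using nz by (intro qvar_power_dvd_cancel[of m r "reflect_poly b"]) auto
  then obtain p' where p': "r = monom 1 m * p'" ..
  have ev_p': "ev p' qvar = V"
    using r by (simp add: p' ev_mult ev_monom mult.commute)
  have p_eq: "p = p'"
    unfolding p_def by (rule new_entry_eqI) (simp only: ev_p' V_def)
  show "ev p qvar = qvar powi (int (degree c) - int (degree b)) *
      exchange (qvar powi \<eta>) (ev b qvar) (ev a qvar) (ev c qvar)"
    by (simp only: p_eq ev_p' V E_def)
  have "ev (p * reflect_poly b) qvar = ev (f + g) qvar"
    by (simp only: p_eq ev_mult ev_p' V_mult)
  hence p_mult: "p * reflect_poly b = f + g"
    by (simp only: ev_qvar_inject)
  have deg_f: "degree f = k + 2 * degree a" and deg_g: "degree g = 2 * degree c"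
    using nz pos by (simp_all add: f_def g_def degree_mult_eq degree_monom_eq
        degree_reflect_positive_ends)
  have lead_f: "lead_coeff f > 0" and lead_g: "lead_coeff g > 0"
    unfolding f_def g_def lead_coeff_mult lead_coeff_monom
      lead_coeff_reflect_positive_ends[OF pos(1)] lead_coeff_reflect_positive_ends[OF pos(3)]
    using pos by (simp_all add: positive_ends_def)
  \<comment> \<open>The two summands have equal degree if \<open>\<eta> = 1\<close> and \<open>deg c = deg a + 1\<close>.\<close>
  have "coeff f (2 * degree c) \<ge> 0"
    using lead_f k(2) by (cases "degree f = 2 * degree c") (auto simp: deg_f coeff_eq_0)
  hence top: "coeff (f + g) (2 * degree c) > 0"
    using lead_g by (simp add: deg_g)
  have deg_fg: "degree (f + g) = 2 * degree c"
    using top k(2) by (intro antisym le_degree degree_add_le) (auto simp: deg_f deg_g)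
  have bottom: "coeff (f + g) 0 > 0"
    using pos by (simp add: f_def g_def coeff_mult_0 positive_ends_def add_nonneg_pos)
  have "p \<noteq> 0"
    using p_mult top by (metis coeff_0 less_irrefl mult_zero_left)
  thus "degree p + degree b = 2 * degree c"
    using nz arg_cong[OF p_mult, of degree] pos(2)
    by (simp add: degree_mult_eq degree_reflect_positive_ends deg_fg)
  have "lead_coeff p * coeff b 0 > 0"
    using arg_cong[OF p_mult, of lead_coeff] top
    by (simp add: lead_coeff_mult lead_coeff_reflect_positive_ends pos deg_fg)
  moreover have "coeff p 0 * lead_coeff b > 0"
    using arg_cong[OF p_mult, of "\<lambda>u. coeff u 0"] bottom by (simp add: coeff_mult_0)
  ultimately show "positive_ends p"
    using pos(2) by (simp add: positive_ends_def zero_less_mult_iff)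
qed

text \<open>The values enter in the cyclic order \<open>(b, a, c)\<close> so that the sign \<open>\<epsilon>\<close> itself, which is that of
  the left edge, is the exponent in the exchange at \<open>b\<close>.\<close>

fun markov_vertex :: "int poly triple \<times> int \<Rightarrow> bool" where
  "markov_vertex ((a, b, c), \<epsilon>) \<longleftrightarrow>
     \<epsilon> \<in> {1, -1} \<and> positive_ends a \<and> positive_ends b \<and> positive_ends c \<and>
     degree a < degree c \<and> degree b < degree c \<and>
     markov_seed (qvar powi \<epsilon>) (ev b qvar) (ev a qvar) (ev c qvar)"

text \<open>Exchanging the first two entries and negating the sign turns right edges into
  left edges, so that only left edges need to be studied.\<close>

lemma child_Go_Right: "child Go_Right ((a, b, c), \<epsilon>) = child Go_Left ((b, a, c), - \<epsilon>)"
  by simp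

lemma markov_vertex_swap:
  assumes "markov_vertex ((a, b, c), \<epsilon>)"
  shows "markov_vertex ((b, a, c), - \<epsilon>)"
proof -
  have "markov_seed (inverse (qvar powi \<epsilon>)) (ev a qvar) (ev b qvar) (ev c qvar)"
    using assms by (auto intro: markov_seed_swap[OF markov_seed_rotate])
  with assms show ?thesis
    by (auto simp: power_int_minus)
qed

lemma ev_new_entry:
  assumes "markov_vertex ((a, b, c), \<epsilon>)"
  shows "ev (new_entry \<epsilon> a c b) qvar = qvar powi (int (degree c) - int (degree b)) *
           exchange (qvar powi \<epsilon>) (ev b qvar) (ev a qvar) (ev c qvar)"
  using assms by (intro new_entry_props) (auto simp: markov_seed_def)

lemma markov_vertex_child_Left:
  assumes v: "markov_vertex ((a, b, c), \<epsilon>)"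
  shows "markov_vertex (child Go_Left ((a, b, c), \<epsilon>))"
proof -
  define p where "p = new_entry \<epsilon> a c b"
  have p: "positive_ends p" "degree p + degree b = 2 * degree c"
    unfolding p_def using v by (intro new_entry_props; auto simp: markov_seed_def)+
  have "markov_seed (qvar powi \<epsilon>) (ev c qvar) (ev a qvar) (ev p qvar)"
    using v p(1) by (intro markov_seed_child[OF _ ev_new_entry[OF v, folded p_def]])
      (auto simp: positive_ends_def)
  with v p show ?thesis
    by (auto simp flip: p_def)
qed

lemma markov_vertex_child:
  assumes "markov_vertex v"
  shows "markov_vertex (child d v)"
proof (cases v rule: markov_vertex.cases)
  case (1 a b c \<epsilon>)
  show ?thesis
  proof (cases d)
    case Go_Left
    with assms 1 show ?thesis
      by (simp only: markov_vertex_child_Left)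
  next
    case Go_Right
    with assms 1 show ?thesis
      by (simp only: child_Go_Right markov_vertex_child_Left markov_vertex_swap)
  qed
qed

text \<open>The initial segment consists of two left steps of sign \<open>1\<close> from \<open>(1, 1, 1)\<close>. The strict degree
  inequalities fail at \<open>(1, 1, 1)\<close>, so these two steps rest on explicit exchange relations.\<close>

lemma initial_exchanges:
  "ev [:1, 1:] qvar = qvar powi 0 * exchange qvar 1 1 1"
  "ev [:1, 2, 2:] qvar = qvar powi 1 * exchange qvar 1 1 (ev [:1, 1:] qvar)"
proof -
  show "ev [:1, 1:] qvar = qvar powi 0 * exchange qvar 1 1 1"
    by (simp add: exchange_def ev_pCons)
  have "qvar * capital [:1, 1:] = 1 + 2 * qvar + qvar ^ 2"
    by (simp add: capital_def ev_pCons field_simps power2_eq_square)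
  thus "ev [:1, 2, 2:] qvar = qvar powi 1 * exchange qvar 1 1 (ev [:1, 1:] qvar)"
    unfolding exchange_def nrm_ev by (simp add: ev_pCons algebra_simps power2_eq_square)
qed

lemma markov_vertex_root: "markov_vertex ((1, [:1, 1:], [:1, 2, 2:]), 1)"
proof -
  have "markov_seed qvar 1 1 (ev [:1, 1:] qvar)"
    by (rule markov_seed_child[OF markov_seed_1 initial_exchanges(1)]) simp
  hence "markov_seed qvar (ev [:1, 1:] qvar) 1 (ev [:1, 2, 2:] qvar)"
    by (rule markov_seed_child[OF _ initial_exchanges(2)]) simp
  thus ?thesis
    by (simp add: positive_ends_def)
qed

section \<open>Comparison with the orbifold model\<close>

text \<open>The sign of a vertex corresponds to the cyclic order of the loops: the loop of \<open>a\<close> follows that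
  of \<open>b\<close> exactly if the sign is \<open>1\<close>.\<close>

fun models :: "loop triple \<times> orbifold_state \<Rightarrow> int poly triple \<times> int \<Rightarrow> bool" where
  "models ((i, j, k), \<sigma>) (t, \<epsilon>) \<longleftrightarrow>
     distinct [i, j, k] \<and> bij (cw \<sigma>) \<and>
     (if \<epsilon> = 1 then cw \<sigma> j = i \<and> cw \<sigma> i = k \<and> cw \<sigma> k = j
      else cw \<sigma> i = j \<and> cw \<sigma> j = k \<and> cw \<sigma> k = i) \<and>
     (\<forall>V. tarc \<sigma> V = q_inv (arc \<sigma> V)) \<and> matches ((i, j, k), \<sigma>) t"

lemma models_swap:
  "models ((i, j, k), \<sigma>) ((a, b, c), \<epsilon>) \<Longrightarrow> \<epsilon> \<in> {1, -1} \<Longrightarrow>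
   models ((j, i, k), \<sigma>) ((b, a, c), - \<epsilon>)"
  by auto

lemma loop_value_eq_capital:
  assumes "tarc \<sigma> W = q_inv (arc \<sigma> W)" "eq_upto_qhalf (arc \<sigma> W) a"
  shows "loop_value \<sigma> W = capital a"
proof -
  have "loop_value \<sigma> W = nrm (arc \<sigma> W)"
    by (simp add: loop_value_def nrm_def assms(1))
  with assms(2) show ?thesis
    by (auto simp: eq_upto_qhalf_def nrm_mult nrm_ev)
qed

text \<open>Both models perform the same exchange. The loop of \<open>a\<close> comes with the factor \<open>q\<^sup>1\<^sup>/\<^sup>2\<close> if it
  follows the mutated loop and with \<open>q\<^sup>-\<^sup>1\<^sup>/\<^sup>2\<close> if it precedes it, so that relative to the
  loop of \<open>c\<close> it carries \<open>q\<^bsup>\<epsilon>\<^esup>\<close>. Reversing the cyclic order leaves the sign unchanged since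
  the positions of the last two loops are exchanged as well.\<close>

lemma models_mutate:
  assumes m: "models ((i, j, k), \<sigma>) ((a, b, c), \<epsilon>)" and \<epsilon>: "\<epsilon> \<in> {1, -1}"
    and p: "ev p qvar = qvar powi n *
      exchange (qvar powi \<epsilon>) (ev b qvar) (ev a qvar) (ev c qvar)"
  shows "models ((i, k, j), mutate j \<sigma>) ((a, c, p), \<epsilon>)"
proof -
  have bij: "bij (cw \<sigma>)" and dist: "i \<noteq> j" "j \<noteq> k" "i \<noteq> k"
    and tarc: "\<And>V. tarc \<sigma> V = q_inv (arc \<sigma> V)"
    and match: "eq_upto_qhalf (arc \<sigma> i) a" "eq_upto_qhalf (arc \<sigma> j) b" "eq_upto_qhalf (arc \<sigma> k) c"
    using m by auto
  have inv: "inv (cw \<sigma>) V = U" if "cw \<sigma> U = V" for U V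
    using bij that by (simp add: bij_is_inj inv_f_eq)
  note loops = loop_value_eq_capital[OF tarc match(1)] loop_value_eq_capital[OF tarc match(3)]
  obtain l where l: "arc \<sigma> j = qhalf powi l * ev b qvar"
    using match(2) by (auto simp: eq_upto_qhalf_def)
  define E where "E = exchange (qvar powi \<epsilon>) (ev b qvar) (ev a qvar) (ev c qvar)"
  have E: "E = (qvar powi \<epsilon> * capital a + capital c) / q_inv (ev b qvar)"
    by (simp add: E_def exchange_def nrm_ev)
  have "arc (mutate j \<sigma>) j
      = qhalf powi (- \<epsilon>) * (qvar powi \<epsilon> * capital a + capital c) / tarc \<sigma> j"
  proof (cases "\<epsilon> = 1")
    case True
    hence "loop_value \<sigma> (cw \<sigma> j) = capital a" "loop_value \<sigma> (inv (cw \<sigma>) j) = capital c"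
      using m loops inv[of k j] by auto
    thus ?thesis
      using True by (simp add: mutate_def Let_def qvar_def field_simps power2_eq_square)
  next
    case False
    hence "loop_value \<sigma> (cw \<sigma> j) = capital c" "loop_value \<sigma> (inv (cw \<sigma>) j) = capital a"
      using m loops inv[of i j] by auto
    moreover have "qhalf * C + inverse qhalf * A = qhalf * (inverse (qhalf ^ 2) * A + C)" for A C
      by (simp add: field_simps power2_eq_square)
    ultimately show ?thesis
      using False \<epsilon> by (simp add: mutate_def Let_def qvar_def)
  qed
  also have "\<dots> = qhalf powi (l - \<epsilon>) * E"
    by (simp add: E tarc l q_inv_mult q_inv_powi q_inv_qhalf power_int_inverse power_int_diff
        power_int_minus field_simps)
  also have "E = qvar powi (- n) * ev p qvar"
    using p by (simp add: E_def power_int_minus)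
  also have "qvar powi (- n) = qhalf powi (2 * - n)"
    by (simp only: power_int_mult) (simp add: qvar_def)
  finally have "arc (mutate j \<sigma>) j = qhalf powi (l - \<epsilon> + 2 * - n) * ev p qvar"
    by (subst power_int_add) (simp_all only: qhalf_nonzero mult.assoc simp_thms)
  hence "eq_upto_qhalf (arc (mutate j \<sigma>) j) p"
    by (auto simp: eq_upto_qhalf_def)
  moreover have "arc (mutate j \<sigma>) V = arc \<sigma> V" if "V \<noteq> j" for V
    using that by (simp add: mutate_def Let_def)
  moreover have "cw (mutate j \<sigma>) = inv (cw \<sigma>)"
    by (simp add: mutate_def Let_def)
  ultimately show ?thesis
    using m dist match tarc_mutate[of \<sigma> j, OF tarc] bij_imp_bij_inv[OF bij]
    by (auto simp: inv split: if_splits)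
qed

lemma follow_step_Go_Right:
  "follow_step Go_Right ((i, j, k), \<sigma>) = follow_step Go_Left ((j, i, k), \<sigma>)"
  by simp

lemma models_step_Left:
  assumes "models ((i, j, k), \<sigma>) ((a, b, c), \<epsilon>)" "markov_vertex ((a, b, c), \<epsilon>)"
  shows "models (follow_step Go_Left ((i, j, k), \<sigma>)) (child Go_Left ((a, b, c), \<epsilon>))"
  using models_mutate[OF assms(1) _ ev_new_entry[OF assms(2)]] assms(2) by simp

lemma models_step:
  assumes "models u v" "markov_vertex v"
  shows "models (follow_step d u) (child d v)"
proof -
  obtain i j k \<sigma> a b c \<epsilon> where uv: "u = ((i, j, k), \<sigma>)" "v = ((a, b, c), \<epsilon>)"
    by (metis prod.exhaust)
  show ?thesis
  proof (cases d)
    case Go_Left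
    with assms uv show ?thesis
      by (simp only: models_step_Left)
  next
    case Go_Right
    have "models ((j, i, k), \<sigma>) ((b, a, c), - \<epsilon>)"
      using assms uv by (intro models_swap) auto
    with assms uv Go_Right show ?thesis
      by (simp only: follow_step_Go_Right child_Go_Right models_step_Left markov_vertex_swap)
  qed
qed

lemma models_initial: "models ((LZ, LY, LX), initial_state) ((1, 1, 1), 1)"
proof -
  have "bij cw_XYZ"
    unfolding bij_def inj_def surj_def
    by (metis (full_types) cw_XYZ.simps loop.exhaust)
  moreover have "eq_upto_qhalf 1 1"
    by (auto simp: eq_upto_qhalf_def intro: exI[of _ 0])
  ultimately show ?thesis
    using tarc_initial_state by (simp add: initial_state_def)
qed

lemma models_initial_Y: "models ((LZ, LX, LY), mutate LY initial_state) ((1, 1, [:1, 1:]), 1)"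
  by (rule models_mutate[OF models_initial, where n = 0]) (use initial_exchanges(1) in simp_all)

lemma models_root: "models ((LZ, LY, LX), mutate LX (mutate LY initial_state))
    ((1, [:1, 1:], [:1, 2, 2:]), 1)"
  by (rule models_mutate[OF models_initial_Y, where n = 1]) (use initial_exchanges(2) in simp_all)

lemma models_follow:
  "models (follow ds) (mirror_vertex ds) \<and> markov_vertex (mirror_vertex ds)"
proof (induction ds rule: rev_induct)
  case Nil
  show ?case
    using models_root markov_vertex_root by (simp add: follow_def mirror_vertex_def)
next
  case (snoc d ds)
  thus ?case
    using models_step markov_vertex_child by (simp add: follow_def mirror_vertex_def)
qed

lemma models_imp_matches: "models u v \<Longrightarrow> matches u (fst v)"
  by (cases "(u, v)" rule: models.cases) auto

theorem proposition4p8: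
  "matches ((LZ, LY, LX), initial_state) (1, 1, 1) \<and>
   matches ((LZ, LX, LY), mutate LY initial_state) (1, 1, [:1, 1:]) \<and>
   (\<forall>ds. matches (follow ds) (mirror_triple ds))"
  using models_imp_matches[OF models_initial] models_imp_matches[OF models_initial_Y]
    models_imp_matches[OF models_follow[THEN conjunct1]]
  by (simp add: mirror_triple_def)

end
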